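(* A graph $G$ has exactly two distinct power domination roots if and only if $G$ is isomorphic to $G_1\,\dot\cup\cdots\dot\cup\, G_k\,\dot\cup\,\overline{K_r}$ for some $k\ge 1$, $r\ge 0$, with $G_i\simeq P_2$ for $1\le i\le k$. Moreover, if $G$ has exactly two distinct power domination roots, these roots are $0$ and $-2$.
   Context: Graphs are finite and simple with nonempty vertex set; $\overline{K_r}$ is the edgeless graph on $r$ vertices (empty if $r=0$), $P_2$ is the path on 2 vertices, $\dot\cup$ is disjoint union. For $S\subseteq V(G)$, $S$ is a power dominating set if, after coloring $S$, coloring every neighbor of a vertex of $S$, and then repeatedly applying the forcing rule (a colored vertex with exactly one uncolored neighbor colors that neighbor) until no changes occur, all vertices are colored. $\mathcal{P}(G;x)=\sum_{i=1}^{|V(G)|}p(G;i)x^i$, where $p(G;i)$ is the number of power dominating sets of size $i$; a power domination root of $G$ is a complex root of $\mathcal{P}(G;x)$. *)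

theory Defs
  imports
    Complex_Main
    "HOL-Computational_Algebra.Polynomial"
    "Graph_Theory.Pair_Digraph"
    "Graph_Theory.Digraph_Isomorphism"
begin

text \<open>
  Finite simple graphs are the graphs of the locale \<^locale>\<open>pair_graph\<close>: a finite vertex set
  with a symmetric, irreflexive set of arcs, an undirected edge \<open>uv\<close> being the pair of arcs
  \<open>(u, v)\<close>, \<open>(v, u)\<close>. That locale admits the empty graph, so nonemptiness of the vertex set is a
  separate hypothesis.
\<close>

definition nbrs :: "'a pair_pre_digraph \<Rightarrow> 'a \<Rightarrow> 'a set" where
  "nbrs G v = {w. (v, w) \<in> parcs G}"

definition closed_nbrs :: "'a pair_pre_digraph \<Rightarrow> 'a set \<Rightarrow> 'a set" where
  "closed_nbrs G S = S \<union> (\<Union>v\<in>S. nbrs G v)"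

definition force_step :: "'a pair_pre_digraph \<Rightarrow> 'a set \<Rightarrow> 'a set" where
  "force_step G C = C \<union> {w. \<exists>u\<in>C. nbrs G u - C = {w}}"

text \<open>
  One application of \<^const>\<open>force_step\<close> performs all currently possible forces simultaneously.
  The iterates increase, so on a finite graph their union is the set of vertices colored when the
  process stops.
\<close>

definition forcing_closure :: "'a pair_pre_digraph \<Rightarrow> 'a set \<Rightarrow> 'a set" where
  "forcing_closure G C = (\<Union>n. (force_step G ^^ n) C)"

definition power_dominating :: "'a pair_pre_digraph \<Rightarrow> 'a set \<Rightarrow> bool" where
  "power_dominating G S \<longleftrightarrow> S \<subseteq> pverts G \<and> forcing_closure G (closed_nbrs G S) = pverts G"

definition num_power_dominating :: "'a pair_pre_digraph \<Rightarrow> nat \<Rightarrow> nat" where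
  "num_power_dominating G i = card {S. power_dominating G S \<and> card S = i}"

definition power_domination_poly :: "'a pair_pre_digraph \<Rightarrow> complex poly" where
  "power_domination_poly G =
     (\<Sum>i = 1..card (pverts G). monom (of_nat (num_power_dominating G i)) i)"

definition power_domination_roots :: "'a pair_pre_digraph \<Rightarrow> complex set" where
  "power_domination_roots G = {z. poly (power_domination_poly G) z = 0}"

definition edgeless_graph :: "nat \<Rightarrow> nat pair_pre_digraph" where
  "edgeless_graph r = \<lparr>pverts = {..<r}, parcs = {}\<rparr>"

definition path_graph :: "nat \<Rightarrow> nat pair_pre_digraph" where
  "path_graph n =
     \<lparr>pverts = {..<n}, parcs = {(i, j). i < n \<and> j < n \<and> (j = Suc i \<or> i = Suc j)}\<rparr>"

definition graph_sum :: "'a pair_pre_digraph \<Rightarrow> 'b pair_pre_digraph \<Rightarrow> ('a + 'b) pair_pre_digraph"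
    (infixl \<open>\<oplus>\<^sub>G\<close> 65) where
  "G \<oplus>\<^sub>G H =
     \<lparr>pverts = pverts G <+> pverts H,
      parcs = {(Inl u, Inl v) | u v. (u, v) \<in> parcs G} \<union> {(Inr u, Inr v) | u v. (u, v) \<in> parcs H}\<rparr>"

definition graph_family_sum ::
    "'i set \<Rightarrow> ('i \<Rightarrow> 'a pair_pre_digraph) \<Rightarrow> ('i \<times> 'a) pair_pre_digraph" where
  "graph_family_sum I F =
     \<lparr>pverts = (SIGMA i:I. pverts (F i)),
      parcs = {((i, u), (i, v)) | i u v. i \<in> I \<and> (u, v) \<in> parcs (F i)}\<rparr>"

abbreviation graph_iso :: "'a pair_pre_digraph \<Rightarrow> 'b pair_pre_digraph \<Rightarrow> bool"
    (infix \<open>\<simeq>\<^sub>G\<close> 50) where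
  "G \<simeq>\<^sub>G H \<equiv> digraph_iso (with_proj G) (with_proj H)"

end

theory Submission
  imports
    Defs
    "HOL-Library.FuncSet"
    "HOL-Computational_Algebra.Fundamental_Theorem_Algebra"
begin

text \<open>
  Let \<open>n\<close> be the order of \<open>G\<close>, \<open>q\<close> the number of isolated vertices and \<open>\<gamma>\<close> the power domination
  number. If the roots are \<open>0\<close> and \<open>z \<noteq> 0\<close>, the polynomial is \<open>x\<^sup>\<gamma> (x - z)\<^sup>m\<close> with \<open>n = \<gamma> + m\<close>.
  Deleting a vertex from the full vertex set leaves a power dominating set iff the vertex is not
  isolated, so comparing second coefficients gives \<open>n - q = - m z\<close>. Thus \<open>z\<close> is rational, and being
  an algebraic integer it is an integer. Some edge exists, so \<open>q < \<gamma>\<close>, which means \<open>m < - m z\<close>;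
  hence \<open>- z \<ge> 2\<close>, that is, \<open>2 \<gamma> \<ge> n + q\<close>.

  By Ore's argument, \<open>G\<close> has two dominating sets that cover all vertices and share only the isolated
  ones; their sizes add up to \<open>n + q\<close>, so both have size \<open>\<gamma>\<close>. As one undominated vertex with a
  neighbour is always forced, no smaller set dominates all but one non-isolated vertex. This makes
  every degree at most 1, i.e. the arc relation single-valued.

  Conversely, if all degrees are at most 1, the power dominating sets are the sets that meet every
  component, and their generating function is a product of factors \<open>x\<close> and \<open>x\<^sup>2 + 2 x\<close>.
\<close>

subsection \<open>Monic polynomials with two roots\<close>

lemma degree_monom_mult_linear_power:
  "degree (monom 1 a * [:- z, 1:] ^ m :: 'a :: idom poly) = a + m"
  by (subst degree_mult_eq) (simp_all add: monom_eq_0_iff degree_monom_eq degree_linear_power)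

lemma coeff_monom_mult_linear_power_pred:
  fixes z :: "'a :: comm_ring_1"
  assumes "m > 0"
  shows "coeff (monom 1 a * [:- z, 1:] ^ m) (a + m - 1) = - (of_nat m * z)"
proof -
  obtain k where "m = Suc k" using assms gr0_implies_Suc by blast
  then show ?thesis by (simp add: coeff_monom_mult coeff_linear_poly_power del: power_Suc)
qed

lemma complex_poly_decompose_two_roots:
  fixes p :: "complex poly"
  assumes "lead_coeff p = 1" and "{x. poly p x = 0} = {0, z}" and "z \<noteq> 0"
  shows "p = monom 1 (order 0 p) * [:- z, 1:] ^ order z p"
  using complex_poly_decompose[of p] assms by (simp add: monom_altdef)

subsection \<open>Sets meeting every block of a partition\<close>

lemma sum_power_card_Pow:
  fixes x :: "'b :: comm_semiring_1"
  assumes "finite B"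
  shows "(\<Sum>T\<in>Pow B. x ^ card T) = (1 + x) ^ card B"
  using prod_add[OF assms, of "\<lambda>_. x" "\<lambda>_. 1"] by (simp add: add.commute)

lemma sum_power_card_hitting_sets_PiE:
  fixes x :: "'b :: comm_semiring_1"
  assumes "finite \<B>" and "\<And>B. B \<in> \<B> \<Longrightarrow> finite B" and "disjoint \<B>"
  shows "(\<Sum>S | S \<subseteq> \<Union>\<B> \<and> (\<forall>B\<in>\<B>. S \<inter> B \<noteq> {}). x ^ card S)
    = (\<Sum>g \<in> (\<Pi>\<^sub>E B\<in>\<B>. Pow B - {{}}). \<Prod>B\<in>\<B>. x ^ card (g B))"
proof -
  let ?N = "\<lambda>B. Pow B - {{}}"
  have choice: "g B \<subseteq> B" "g B \<noteq> {}" if "g \<in> Pi\<^sub>E \<B> ?N" "B \<in> \<B>" for g B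
    using PiE_mem[OF that] by auto
  have disj: "B \<inter> C = {}" if "B \<in> \<B>" "C \<in> \<B>" "B \<noteq> C" for B C
    using pairwiseD[OF assms(3) that] by (simp add: disjnt_def)
  have restore: "(\<Union>C\<in>\<B>. g C) \<inter> B = g B" if g: "g \<in> Pi\<^sub>E \<B> ?N" and B: "B \<in> \<B>" for g B
  proof -
    have "g C \<inter> B = {}" if "C \<in> \<B>" "C \<noteq> B" for C
      using choice(1)[OF g that(1)] disj[OF that(1) B that(2)] by blast
    then show ?thesis using B choice(1)[OF g B] by blast
  qed
  show ?thesis
  proof (rule sum.reindex_bij_witness[of _ "\<lambda>g. \<Union>B\<in>\<B>. g B" "\<lambda>S. \<lambda>B\<in>\<B>. S \<inter> B"])
    fix g assume g: "g \<in> Pi\<^sub>E \<B> ?N"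
    show "(\<lambda>B\<in>\<B>. (\<Union>C\<in>\<B>. g C) \<inter> B) = g"
      using restore[OF g] PiE_arb[OF g] by (intro ext) (simp add: restrict_def)
    have "(\<Union>B\<in>\<B>. g B) \<subseteq> \<Union>\<B>" using choice(1)[OF g] by blast
    then show "(\<Union>B\<in>\<B>. g B) \<in> {S. S \<subseteq> \<Union>\<B> \<and> (\<forall>B\<in>\<B>. S \<inter> B \<noteq> {})}"
      using restore[OF g] choice(2)[OF g] by simp
  next
    fix S assume "S \<in> {S. S \<subseteq> \<Union>\<B> \<and> (\<forall>B\<in>\<B>. S \<inter> B \<noteq> {})}"
    then have "S = (\<Union>B\<in>\<B>. S \<inter> B)" by auto
    also have "card \<dots> = (\<Sum>B\<in>\<B>. card (S \<inter> B))"
      using assms(1,2) disj by (intro card_UN_disjoint) blast+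
    finally show "(\<Prod>B\<in>\<B>. x ^ card ((\<lambda>B\<in>\<B>. S \<inter> B) B)) = x ^ card S"
      by (simp add: power_sum)
  qed auto
qed

lemma sum_power_card_hitting_sets:
  fixes x :: "'b :: comm_ring_1"
  assumes "finite \<B>" and "\<And>B. B \<in> \<B> \<Longrightarrow> finite B" and "disjoint \<B>"
  shows "(\<Sum>S | S \<subseteq> \<Union>\<B> \<and> (\<forall>B\<in>\<B>. S \<inter> B \<noteq> {}). x ^ card S) = (\<Prod>B\<in>\<B>. (1 + x) ^ card B - 1)"
proof -
  have "(\<Prod>B\<in>\<B>. (1 + x) ^ card B - 1) = (\<Prod>B\<in>\<B>. \<Sum>T\<in>Pow B - {{}}. x ^ card T)"
    using assms(2) by (intro prod.cong) (simp_all add: sum_diff1 sum_power_card_Pow)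
  also have "\<dots> = (\<Sum>g \<in> (\<Pi>\<^sub>E B\<in>\<B>. Pow B - {{}}). \<Prod>B\<in>\<B>. x ^ card (g B))"
    using assms(1,2) by (intro prod_sum_PiE) auto
  finally show ?thesis using sum_power_card_hitting_sets_PiE[OF assms] by simp
qed

subsection \<open>Forcing and domination\<close>

lemma force_step_superset: "C \<subseteq> force_step G C"
  by (auto simp: force_step_def)

lemma force_step_mono: "C \<subseteq> D \<Longrightarrow> force_step G C \<subseteq> force_step G D"
  unfolding force_step_def by blast

lemma force_step_subset_forcing_closure: "force_step G C \<subseteq> forcing_closure G C"
proof -
  have "(force_step G ^^ 1) C \<subseteq> forcing_closure G C"
    unfolding forcing_closure_def by blast
  then show ?thesis by simp
qed

lemma forcing_closure_least:
  assumes "C \<subseteq> D" and "force_step G D = D"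
  shows "forcing_closure G C \<subseteq> D"
proof -
  have "(force_step G ^^ n) C \<subseteq> D" for n
  proof (induction n)
    case (Suc n)
    then have "force_step G ((force_step G ^^ n) C) \<subseteq> force_step G D" by (rule force_step_mono)
    then show ?case by (simp add: assms(2))
  qed (simp add: assms(1))
  then show ?thesis by (auto simp: forcing_closure_def)
qed

lemma in_closed_nbrs_iff: "v \<in> closed_nbrs G S \<longleftrightarrow> v \<in> S \<or> (\<exists>u\<in>S. v \<in> nbrs G u)"
  by (auto simp: closed_nbrs_def)

definition isolated_verts :: "'a pair_pre_digraph \<Rightarrow> 'a set" where
  "isolated_verts G = {v \<in> pverts G. nbrs G v = {}}"

definition dominating :: "'a pair_pre_digraph \<Rightarrow> 'a set \<Rightarrow> bool" where
  "dominating G S \<longleftrightarrow> S \<subseteq> pverts G \<and> pverts G \<subseteq> closed_nbrs G S"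

lemma closed_nbrs_singleton: "closed_nbrs G {v} = insert v (nbrs G v)"
  by (simp add: closed_nbrs_def)

lemma nbrs_eq_singleton:
  assumes "single_valued (parcs G)" and "w \<in> nbrs G v"
  shows "nbrs G v = {w}"
  using assms by (auto simp: nbrs_def dest: single_valuedD)

context pair_graph
begin

lemma nbrs_sym: "v \<in> nbrs G u \<longleftrightarrow> u \<in> nbrs G v"
  using arcs_symmetric by (auto simp: nbrs_def)

lemma nbrs_irrefl: "v \<notin> nbrs G v"
  using pair_no_loops[of "(v, v)"] by (auto simp: nbrs_def)

lemma nbrs_subset: "nbrs G v \<subseteq> pverts G"
  by (auto simp: nbrs_def dest: in_arcsD2)

lemma isolated_verts_subset: "isolated_verts G \<subseteq> pverts G"
  by (auto simp: isolated_verts_def)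

lemma isolated_vert_notin_nbrs: "v \<in> isolated_verts G \<Longrightarrow> v \<notin> nbrs G u"
  using nbrs_sym by (auto simp: isolated_verts_def)

lemma finite_subset_verts: "S \<subseteq> pverts G \<Longrightarrow> finite S"
  using pair_finite_verts by (rule finite_subset[rotated])

lemma power_dominatingI:
  assumes "S \<subseteq> pverts G" and "pverts G \<subseteq> force_step G (closed_nbrs G S)"
  shows "power_dominating G S"
proof -
  have "closed_nbrs G S \<subseteq> pverts G"
    using assms(1) nbrs_subset by (auto simp: closed_nbrs_def)
  moreover have "force_step G (pverts G) = pverts G"
    using nbrs_subset by (auto simp: force_step_def)
  ultimately have "forcing_closure G (closed_nbrs G S) \<subseteq> pverts G"
    by (rule forcing_closure_least)
  with assms show ?thesis
    using force_step_subset_forcing_closure[of G "closed_nbrs G S"]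
    by (auto simp: power_dominating_def)
qed

lemma power_dominating_if_dominating:
  assumes "dominating G S"
  shows "power_dominating G S"
  using assms force_step_superset[of "closed_nbrs G S" G]
  by (intro power_dominatingI) (auto simp: dominating_def)

lemma power_dominating_if_almost_dominating:
  assumes "S \<subseteq> pverts G" and "pverts G - {w} \<subseteq> closed_nbrs G S" and "w \<notin> isolated_verts G"
  shows "power_dominating G S"
proof (cases "pverts G \<subseteq> closed_nbrs G S")
  case True
  with assms(1) show ?thesis by (simp add: power_dominating_if_dominating dominating_def)
next
  case False
  then have w: "w \<in> pverts G" "w \<notin> closed_nbrs G S" using assms(2) by auto
  then obtain u where u: "u \<in> nbrs G w" using assms(3) by (auto simp: isolated_verts_def)
  then have "u \<in> closed_nbrs G S" using assms(2) nbrs_subset nbrs_irrefl by blast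
  moreover have "nbrs G u - closed_nbrs G S = {w}"
    using u w assms(2) nbrs_subset nbrs_sym by blast
  ultimately have "w \<in> force_step G (closed_nbrs G S)" by (auto simp: force_step_def)
  then show ?thesis
    using assms(1,2) force_step_superset[of "closed_nbrs G S" G] by (intro power_dominatingI) auto
qed

lemma isolated_verts_subset_power_dominating:
  assumes "power_dominating G S"
  shows "isolated_verts G \<subseteq> S"
proof
  fix v assume v: "v \<in> isolated_verts G"
  show "v \<in> S"
  proof (rule ccontr)
    assume "v \<notin> S"
    then have "closed_nbrs G S \<subseteq> - {v}"
      using isolated_vert_notin_nbrs[OF v] by (auto simp: closed_nbrs_def)
    moreover have "force_step G (- {v}) = - {v}"
      using isolated_vert_notin_nbrs[OF v] by (auto simp: force_step_def)
    ultimately have "forcing_closure G (closed_nbrs G S) \<subseteq> - {v}"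
      by (rule forcing_closure_least)
    with assms v show False by (auto simp: power_dominating_def isolated_verts_def)
  qed
qed

lemma power_dominating_imp_dominating_if_stalled:
  assumes "power_dominating G S" and "force_step G (closed_nbrs G S) = closed_nbrs G S"
  shows "dominating G S"
  using assms forcing_closure_least[OF order.refl assms(2)]
  by (simp add: power_dominating_def dominating_def)

lemma power_dominating_isolated_verts_iff:
  "power_dominating G (isolated_verts G) \<longleftrightarrow> parcs G = {}"
proof
  let ?Z = "isolated_verts G"
  have "closed_nbrs G ?Z = ?Z" by (auto simp: closed_nbrs_def isolated_verts_def)
  moreover have "force_step G ?Z = ?Z" by (auto simp: force_step_def isolated_verts_def)
  moreover assume "power_dominating G ?Z"
  ultimately have "pverts G \<subseteq> ?Z"
    using power_dominating_imp_dominating_if_stalled[of ?Z] by (simp add: dominating_def)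
  then show "parcs G = {}" by (auto simp: isolated_verts_def nbrs_def dest: in_arcsD1)
next
  assume "parcs G = {}"
  then have "dominating G (isolated_verts G)"
    by (auto simp: dominating_def isolated_verts_def nbrs_def closed_nbrs_def)
  then show "power_dominating G (isolated_verts G)" by (rule power_dominating_if_dominating)
qed

end

subsection \<open>The power domination number\<close>

definition power_domination_number :: "'a pair_pre_digraph \<Rightarrow> nat" where
  "power_domination_number G = (LEAST k. \<exists>S. power_dominating G S \<and> card S = k)"

lemma power_domination_number_le: "power_dominating G S \<Longrightarrow> power_domination_number G \<le> card S"
  unfolding power_domination_number_def by (rule Least_le) blast

context pair_graph
begin

lemma dominating_verts: "dominating G (pverts G)"
  by (auto simp: dominating_def closed_nbrs_def)

lemma power_domination_number_attained:
  obtains S where "power_dominating G S" and "card S = power_domination_number G"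
proof -
  have "\<exists>k S. power_dominating G S \<and> card S = k"
    using power_dominating_if_dominating[OF dominating_verts] by blast
  then have "\<exists>S. power_dominating G S \<and> card S = power_domination_number G"
    unfolding power_domination_number_def by (rule LeastI_ex)
  then show thesis using that by blast
qed

lemma card_isolated_verts_less_power_domination_number:
  assumes "parcs G \<noteq> {}"
  shows "card (isolated_verts G) < power_domination_number G"
proof -
  obtain S where S: "power_dominating G S" "card S = power_domination_number G"
    by (rule power_domination_number_attained)
  have "isolated_verts G \<noteq> S" using S(1) assms power_dominating_isolated_verts_iff by blast
  with isolated_verts_subset_power_dominating[OF S(1)] have "isolated_verts G \<subset> S" by blast
  moreover have "finite S" using S(1) by (simp add: power_dominating_def finite_subset_verts)
  ultimately show ?thesis using S(2) psubset_card_mono by metis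
qed

subsection \<open>Graphs with the largest possible power domination number\<close>

lemma dominating_complement_of_minimal:
  assumes D: "dominating G D" and minimal: "\<And>v. v \<in> D \<Longrightarrow> \<not> dominating G (D - {v})"
  shows "dominating G (pverts G - D \<union> isolated_verts G)"
proof -
  let ?D' = "pverts G - D \<union> isolated_verts G"
  have "v \<in> closed_nbrs G ?D'" if v: "v \<in> D" "v \<notin> isolated_verts G" for v
  proof -
    obtain x where x: "x \<in> pverts G" "x \<notin> closed_nbrs G (D - {v})"
      using minimal[OF v(1)] D by (auto simp: dominating_def)
    show ?thesis
    proof (cases "x = v")
      case True
      obtain y where y: "y \<in> nbrs G v" using v D by (auto simp: isolated_verts_def dominating_def)
      then have "y \<notin> D" using x(2) True nbrs_irrefl nbrs_sym by (auto simp: in_closed_nbrs_iff)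
      then have "y \<in> ?D'" "v \<in> nbrs G y" using y nbrs_subset nbrs_sym by auto
      then show ?thesis by (auto simp: in_closed_nbrs_iff)
    next
      case False
      have "x \<in> closed_nbrs G D" using D x(1) by (auto simp: dominating_def)
      then have "x \<notin> D" "x \<in> nbrs G v" using x(2) False by (auto simp: in_closed_nbrs_iff)
      then show ?thesis using x(1) nbrs_sym by (auto simp: in_closed_nbrs_iff)
    qed
  qed
  moreover have "?D' \<subseteq> closed_nbrs G ?D'" by (auto simp: closed_nbrs_def)
  ultimately show ?thesis using isolated_verts_subset unfolding dominating_def by blast
qed

lemma dominating_coverE:
  obtains D D' where "dominating G D" and "dominating G D'"
    and "D \<union> D' = pverts G" and "D \<inter> D' = isolated_verts G"
proof -
  have "finite {D. dominating G D}"
    by (rule finite_subset[of _ "Pow (pverts G)"]) (auto simp: dominating_def pair_finite_verts)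
  from finite_has_minimal2[OF this, of "pverts G"] dominating_verts
  obtain D where D: "dominating G D" and minimal: "\<And>T. dominating G T \<Longrightarrow> T \<subseteq> D \<Longrightarrow> D = T"
    by auto
  have "\<not> dominating G (D - {v})" if "v \<in> D" for v
    using minimal[of "D - {v}"] that by blast
  then have D': "dominating G (pverts G - D \<union> isolated_verts G)"
    by (rule dominating_complement_of_minimal[OF D])
  have "isolated_verts G \<subseteq> D"
    using D by (intro isolated_verts_subset_power_dominating power_dominating_if_dominating)
  moreover have "D \<subseteq> pverts G" using D by (simp add: dominating_def)
  ultimately have "D \<union> (pverts G - D \<union> isolated_verts G) = pverts G"
    "D \<inter> (pverts G - D \<union> isolated_verts G) = isolated_verts G"
    by (auto simp: isolated_verts_def)
  with D D' show thesis by (rule that)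
qed

lemma card_dominating_cover:
  assumes "D \<union> D' = pverts G" and "D \<inter> D' = isolated_verts G"
  shows "card D + card D' = card (pverts G) + card (isolated_verts G)"
proof -
  have "finite D" "finite D'" using assms(1) finite_subset_verts by blast+
  from card_Un_Int[OF this] show ?thesis by (simp add: assms)
qed

lemma external_private_nbr:
  assumes D: "dominating G D" "card D = power_domination_number G"
    and v: "v \<in> D" "v \<notin> isolated_verts G"
  shows "\<exists>x \<in> pverts G - D. nbrs G x \<inter> D = {v}"
proof -
  have sub: "D \<subseteq> pverts G" using D(1) by (simp add: dominating_def)
  have "\<not> power_dominating G (D - {v})"
    using power_domination_number_le D(2) card_Diff1_less[OF finite_subset_verts[OF sub] v(1)]
    by fastforce
  then have "\<not> pverts G - {v} \<subseteq> closed_nbrs G (D - {v})"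
    using power_dominating_if_almost_dominating v(2) sub by blast
  then obtain x where x: "x \<in> pverts G" "x \<noteq> v" "x \<notin> closed_nbrs G (D - {v})" by blast
  moreover have "x \<in> closed_nbrs G D" using D(1) x(1) by (auto simp: dominating_def)
  ultimately have "x \<notin> D" "nbrs G x \<inter> D = {v}"
    using nbrs_sym by (auto simp: in_closed_nbrs_iff)
  with x(1) show ?thesis by blast
qed

lemma external_private_nbr_bij_betw:
  assumes D: "dominating G D" "card D = power_domination_number G"
    and extremal: "card (pverts G) + card (isolated_verts G) \<le> 2 * power_domination_number G"
  obtains p where "bij_betw p (pverts G - D) (D - isolated_verts G)"
    and "\<And>x. x \<in> pverts G - D \<Longrightarrow> nbrs G x \<inter> D = {p x}"
proof -
  let ?A = "D - isolated_verts G" and ?B = "pverts G - D"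
  have "D \<subseteq> pverts G" "isolated_verts G \<subseteq> D"
    using D(1) by (simp_all add: dominating_def isolated_verts_subset_power_dominating
        power_dominating_if_dominating)
  then have "card ?B = card (pverts G) - card D" "card ?A = card D - card (isolated_verts G)"
    using finite_subset_verts isolated_verts_subset by (auto intro!: card_Diff_subset)
  then have card: "card ?B \<le> card ?A" using D(2) extremal by linarith
  have "\<exists>g. \<forall>v\<in>?A. g v \<in> ?B \<and> nbrs G (g v) \<inter> D = {v}"
    using external_private_nbr[OF D] by (intro bchoice) blast
  then obtain g where g: "\<And>v. v \<in> ?A \<Longrightarrow> g v \<in> ?B" "\<And>v. v \<in> ?A \<Longrightarrow> nbrs G (g v) \<inter> D = {v}"
    by blast
  have inj: "inj_on g ?A" using g(2) by (metis inj_onI singleton_inject)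
  then have "g ` ?A = ?B"
    using g(1) card pair_finite_verts by (intro card_seteq) (auto simp: card_image)
  then have "bij_betw (the_inv_into ?A g) ?B ?A"
    using inj by (intro bij_betw_the_inv_into) (simp add: bij_betw_def)
  moreover have "nbrs G x \<inter> D = {the_inv_into ?A g x}" if "x \<in> ?B" for x
    using that g(2) \<open>g ` ?A = ?B\<close> the_inv_into_f_f[OF inj] by (metis imageE)
  ultimately show thesis by (rule that)
qed

text \<open>
  Trading the private partners of two adjacent vertices for one of these vertices leaves only
  one vertex undominated.
\<close>

lemma power_dominating_trade_partners:
  assumes "dominating G D"
    and p: "bij_betw p (pverts G - D) (D - isolated_verts G)"
    and nbrs: "\<And>x. x \<in> pverts G - D \<Longrightarrow> nbrs G x \<inter> D = {p x}"
    and x: "x \<in> pverts G - D" and y: "y \<in> pverts G - D" and "y \<in> nbrs G x"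
  shows "power_dominating G (insert x (D - {p x, p y}))"
proof -
  let ?S = "insert x (D - {p x, p y})"
  have "w \<in> closed_nbrs G ?S" if w: "w \<in> pverts G - {p y}" for w
  proof -
    consider "w = p x" | "w \<in> D" "w \<noteq> p x" | "w = x" | "w = y"
      | "w \<in> pverts G - D" "w \<noteq> x" "w \<noteq> y"
      using w by blast
    then show ?thesis
    proof cases
      case 1
      then show ?thesis using nbrs[OF x] by (auto simp: in_closed_nbrs_iff)
    next
      case 5
      then have "p w \<in> D" "p w \<noteq> p x" "p w \<noteq> p y"
        using p x y bij_betwE[OF p] by (auto simp: bij_betw_def inj_on_eq_iff)
      moreover have "w \<in> nbrs G (p w)" using nbrs[OF 5(1)] nbrs_sym by blast
      ultimately show ?thesis by (auto simp: in_closed_nbrs_iff)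
    qed (use w \<open>y \<in> nbrs G x\<close> in \<open>auto simp: in_closed_nbrs_iff\<close>)
  qed
  moreover have "?S \<subseteq> pverts G" using assms(1) x by (auto simp: dominating_def)
  moreover have "p y \<notin> isolated_verts G" using bij_betwE[OF p] y by blast
  ultimately show ?thesis by (intro power_dominating_if_almost_dominating[of _ "p y"]) auto
qed

lemma nbrs_eq_singleton_if_extremal:
  assumes D: "dominating G D" "card D = power_domination_number G"
    and extremal: "card (pverts G) + card (isolated_verts G) \<le> 2 * power_domination_number G"
    and x: "x \<in> pverts G - D"
  shows "\<exists>v. nbrs G x = {v}"
proof -
  obtain p where p: "bij_betw p (pverts G - D) (D - isolated_verts G)"
    and nbrs: "\<And>y. y \<in> pverts G - D \<Longrightarrow> nbrs G y \<inter> D = {p y}"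
    using external_private_nbr_bij_betw[OF D extremal] by blast
  have fin: "finite D" using D(1) by (simp add: dominating_def finite_subset_verts)
  have "y \<in> D" if y: "y \<in> nbrs G x" for y
  proof (rule ccontr)
    assume "y \<notin> D"
    with y have yB: "y \<in> pverts G - D" and "y \<noteq> x" using nbrs_subset nbrs_irrefl by auto
    then have "p x \<noteq> p y" using p x by (auto simp: bij_betw_def inj_on_eq_iff)
    moreover have "p x \<in> D" "p y \<in> D" using bij_betwE[OF p] x yB by blast+
    ultimately have "{p x, p y} \<subseteq> D" "card {p x, p y} = 2" "2 \<le> card D"
      using card_mono[OF fin, of "{p x, p y}"] by simp_all
    then have "card (insert x (D - {p x, p y})) < card D"
      using x fin by (simp add: card_Diff_subset)
    then show False
      using power_domination_number_le[OF power_dominating_trade_partners[OF D(1) p nbrs x yB y]]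
        D(2) by simp
  qed
  then have "nbrs G x = nbrs G x \<inter> D" by blast
  also have "\<dots> = {p x}" using x by (rule nbrs)
  finally show ?thesis by blast
qed

lemma single_valued_if_power_domination_number_maximal:
  assumes "card (pverts G) + card (isolated_verts G) \<le> 2 * power_domination_number G"
  shows "single_valued (parcs G)"
proof (rule single_valuedI)
  fix x u v assume "(x, u) \<in> parcs G" "(x, v) \<in> parcs G"
  then have uv: "u \<in> nbrs G x" "v \<in> nbrs G x" and x: "x \<in> pverts G" "x \<notin> isolated_verts G"
    by (auto simp: nbrs_def isolated_verts_def dest: in_arcsD1)
  obtain D D' where D: "dominating G D" "dominating G D'"
    and cover: "D \<union> D' = pverts G" "D \<inter> D' = isolated_verts G"
    by (rule dominating_coverE)
  have "power_domination_number G \<le> card D" "power_domination_number G \<le> card D'"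
    using D by (simp_all add: power_domination_number_le power_dominating_if_dominating)
  then have card: "card D = power_domination_number G" "card D' = power_domination_number G"
    using assms card_dominating_cover[OF cover] by linarith+
  have "x \<in> pverts G - D \<or> x \<in> pverts G - D'" using x cover by auto
  then obtain y where "nbrs G x = {y}"
    using nbrs_eq_singleton_if_extremal[OF _ _ assms] D card by blast
  then show "u = v" using uv by simp
qed

subsection \<open>The power domination polynomial\<close>

lemma finite_power_dominating_sets: "finite {S. power_dominating G S}"
  by (rule finite_subset[of _ "Pow (pverts G)"])
    (auto simp: power_dominating_def pair_finite_verts)

lemma power_dominating_nonempty:
  assumes "power_dominating G S" and "pverts G \<noteq> {}"
  shows "S \<noteq> {}"
proof
  assume "S = {}"
  have "forcing_closure G {} \<subseteq> {}" by (rule forcing_closure_least) (simp_all add: force_step_def)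
  with assms \<open>S = {}\<close> show False by (simp add: power_dominating_def closed_nbrs_def)
qed

lemma card_power_dominating_bounds:
  assumes "power_dominating G S" and "pverts G \<noteq> {}"
  shows "card S \<in> {1..card (pverts G)}"
proof -
  have S: "S \<subseteq> pverts G" using assms by (simp add: power_dominating_def)
  then have "card S \<noteq> 0" using finite_subset_verts power_dominating_nonempty assms by simp
  then show ?thesis using card_mono[OF pair_finite_verts S] by simp
qed

lemma power_domination_poly_altdef:
  assumes "pverts G \<noteq> {}"
  shows "power_domination_poly G = (\<Sum>S | power_dominating G S. monom 1 (card S))"
proof -
  have "(\<Sum>S | power_dominating G S. monom 1 (card S) :: complex poly)
      = (\<Sum>i = 1..card (pverts G).
          \<Sum>S | S \<in> {S. power_dominating G S} \<and> card S = i. monom 1 (card S))"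
    using finite_power_dominating_sets card_power_dominating_bounds[OF _ assms]
    by (intro sum.group[symmetric]) auto
  also have "\<dots> = (\<Sum>i = 1..card (pverts G). monom (of_nat (num_power_dominating G i)) i)"
    by (intro sum.cong) (simp_all add: num_power_dominating_def of_nat_monom mult_monom)
  finally show ?thesis by (simp add: power_domination_poly_def)
qed

lemma poly_power_domination_poly:
  "pverts G \<noteq> {} \<Longrightarrow> poly (power_domination_poly G) x = (\<Sum>S | power_dominating G S. x ^ card S)"
  by (simp add: power_domination_poly_altdef poly_sum poly_monom)

lemma coeff_power_domination_poly:
  assumes "pverts G \<noteq> {}"
  shows "coeff (power_domination_poly G) i = of_nat (num_power_dominating G i)"
  using sum.inter_filter[OF finite_power_dominating_sets, of "\<lambda>_. 1 :: complex" "\<lambda>S. card S = i"]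
  by (simp add: power_domination_poly_altdef[OF assms] coeff_sum num_power_dominating_def)

lemma num_power_dominating_eq_0_iff:
  "num_power_dominating G i = 0 \<longleftrightarrow> (\<forall>S. power_dominating G S \<longrightarrow> card S \<noteq> i)"
  using finite_power_dominating_sets by (auto simp: num_power_dominating_def)

lemma num_power_dominating_card_verts: "num_power_dominating G (card (pverts G)) = 1"
proof -
  have "{S. power_dominating G S \<and> card S = card (pverts G)} = {pverts G}"
    using power_dominating_if_dominating[OF dominating_verts] card_subset_eq[OF pair_finite_verts]
    by (auto simp: power_dominating_def)
  then show ?thesis by (simp add: num_power_dominating_def)
qed

lemma power_dominating_verts_Diff_singleton_iff:
  assumes "v \<in> pverts G"
  shows "power_dominating G (pverts G - {v}) \<longleftrightarrow> v \<notin> isolated_verts G"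
proof
  assume "power_dominating G (pverts G - {v})"
  then show "v \<notin> isolated_verts G" using isolated_verts_subset_power_dominating by blast
next
  assume "v \<notin> isolated_verts G"
  then show "power_dominating G (pverts G - {v})"
    by (rule power_dominating_if_almost_dominating[rotated 2]) (auto simp: closed_nbrs_def)
qed

lemma num_power_dominating_card_verts_minus_1:
  assumes "pverts G \<noteq> {}"
  shows "num_power_dominating G (card (pverts G) - 1) = card (pverts G) - card (isolated_verts G)"
proof -
  let ?V = "pverts G" and ?W = "pverts G - isolated_verts G"
  have "{S. power_dominating G S \<and> card S = card ?V - 1} = (\<lambda>v. ?V - {v}) ` ?W"
  proof (intro equalityI subsetI)
    fix S assume S: "S \<in> {S. power_dominating G S \<and> card S = card ?V - 1}"
    then have sub: "S \<subseteq> ?V" by (simp add: power_dominating_def)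
    have "card (?V - S) = 1"
      using S sub assms pair_finite_verts card_gt_0_iff[of ?V]
      by (simp add: card_Diff_subset finite_subset_verts)
    then obtain v where v: "?V - S = {v}" by (rule card_1_singletonE)
    then have "S = ?V - {v}" "v \<in> ?V" using sub by blast+
    then show "S \<in> (\<lambda>v. ?V - {v}) ` ?W"
      using S power_dominating_verts_Diff_singleton_iff by blast
  qed (use pair_finite_verts power_dominating_verts_Diff_singleton_iff in auto)
  moreover have "inj_on (\<lambda>v. ?V - {v}) ?W" by (rule inj_onI) blast
  moreover have "card ?W = card ?V - card (isolated_verts G)"
    using isolated_verts_subset finite_subset_verts by (intro card_Diff_subset) auto
  ultimately show ?thesis by (simp add: num_power_dominating_def card_image)
qed

lemma degree_power_domination_poly:
  assumes "pverts G \<noteq> {}"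
  shows "degree (power_domination_poly G) = card (pverts G)"
proof (rule antisym)
  show "degree (power_domination_poly G) \<le> card (pverts G)"
    unfolding power_domination_poly_def
    by (intro degree_sum_le) (auto intro: order.trans[OF degree_monom_le])
  show "card (pverts G) \<le> degree (power_domination_poly G)"
    by (rule le_degree)
      (simp add: coeff_power_domination_poly[OF assms] num_power_dominating_card_verts)
qed

lemma lead_coeff_power_domination_poly:
  "pverts G \<noteq> {} \<Longrightarrow> lead_coeff (power_domination_poly G) = 1"
  by (simp add: degree_power_domination_poly coeff_power_domination_poly
      num_power_dominating_card_verts)

lemma order_0_power_domination_poly:
  assumes "pverts G \<noteq> {}"
  shows "order 0 (power_domination_poly G) = power_domination_number G"
proof -
  let ?P = "power_domination_poly G" and ?g = "power_domination_number G"
  have P: "?P \<noteq> 0" using lead_coeff_power_domination_poly[OF assms] by auto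
  have "coeff ?P k = 0" if "k < ?g" for k
    using that power_domination_number_le
    by (fastforce simp: coeff_power_domination_poly[OF assms] num_power_dominating_eq_0_iff)
  then have "?g \<le> order 0 ?P" by (simp add: monom_1_dvd_iff' flip: monom_1_dvd_iff[OF P])
  moreover have "coeff ?P ?g \<noteq> 0"
    using power_domination_number_attained
    by (metis coeff_power_domination_poly[OF assms] num_power_dominating_eq_0_iff of_nat_eq_0_iff)
  then have "\<not> Suc ?g \<le> order 0 ?P"
    by (auto simp: monom_1_dvd_iff' simp flip: monom_1_dvd_iff[OF P])
  ultimately show ?thesis by simp
qed

lemma zero_in_power_domination_roots: "0 \<in> power_domination_roots G"
  by (auto simp: power_domination_roots_def power_domination_poly_def poly_sum poly_monom
      intro: sum.neutral)

lemma algebraic_int_power_domination_root: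
  assumes "pverts G \<noteq> {}" and "z \<in> power_domination_roots G"
  shows "algebraic_int z"
proof (rule algebraic_int.intros)
  show "lead_coeff (power_domination_poly G) = 1"
    using assms(1) by (rule lead_coeff_power_domination_poly)
  show "\<forall>i. coeff (power_domination_poly G) i \<in> \<int>"
    by (simp add: coeff_power_domination_poly[OF assms(1)])
  show "poly (power_domination_poly G) z = 0"
    using assms(2) by (simp add: power_domination_roots_def)
qed

subsection \<open>Two roots force degrees at most one\<close>

lemma nonzero_power_domination_root_equations:
  assumes nonempty: "pverts G \<noteq> {}" and roots: "power_domination_roots G = {0, z}" and "z \<noteq> 0"
  defines "m \<equiv> order z (power_domination_poly G)"
  shows "m > 0" and "card (pverts G) = power_domination_number G + m"
    and "of_nat (card (pverts G) - card (isolated_verts G)) = - (of_nat m * z)"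
proof -
  let ?P = "power_domination_poly G" and ?g = "power_domination_number G"
  have zeros: "{x. poly ?P x = 0} = {0, z}" using roots by (simp add: power_domination_roots_def)
  have "?P \<noteq> 0" using lead_coeff_power_domination_poly[OF nonempty] by auto
  then show m: "m > 0" using zeros by (auto simp: m_def order_gt_0_iff)
  have P: "?P = monom 1 ?g * [:- z, 1:] ^ m"
    using complex_poly_decompose_two_roots[OF _ zeros \<open>z \<noteq> 0\<close>]
    by (simp add: lead_coeff_power_domination_poly order_0_power_domination_poly nonempty m_def)
  then show n: "card (pverts G) = ?g + m"
    using degree_power_domination_poly[OF nonempty] degree_monom_mult_linear_power[of ?g z m]
    by simp
  show "of_nat (card (pverts G) - card (isolated_verts G)) = - (of_nat m * z)"
    using coeff_monom_mult_linear_power_pred[OF m, of ?g z] coeff_power_domination_poly[OF nonempty]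
      num_power_dominating_card_verts_minus_1[OF nonempty] by (simp flip: P n)
qed

lemma nonzero_power_domination_root_negative_int:
  assumes nonempty: "pverts G \<noteq> {}" and roots: "power_domination_roots G = {0, z}" and "z \<noteq> 0"
  obtains s :: nat where "z = - of_nat s" and "s > 0"
proof -
  define m where "m = order z (power_domination_poly G)"
  define w where "w = card (pverts G) - card (isolated_verts G)"
  note eqs = nonzero_power_domination_root_equations[OF assms, folded m_def w_def]
  then have "z = - (of_nat w / of_nat m)" by (simp add: field_simps)
  then have "z \<in> \<rat>" by simp
  then have "z \<in> \<int>"
    using roots algebraic_int_power_domination_root[OF nonempty]
    by (intro rational_algebraic_int_is_int) auto
  then obtain i where i: "z = of_int i" by (rule Ints_cases)
  then have "of_int (i * int m) = (of_int (- int w) :: complex)"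
    using eqs(3) by (simp add: mult.commute)
  then have "i * int m = - int w" by (simp only: of_int_eq_iff)
  then have "i * int m \<le> 0" by simp
  then have "i \<le> 0" using eqs(1) by (simp add: mult_le_0_iff)
  then show thesis using that[of "nat (- i)"] i \<open>z \<noteq> 0\<close> by auto
qed

lemma two_power_domination_rootsD:
  assumes nonempty: "pverts G \<noteq> {}" and "card (power_domination_roots G) = 2"
  shows "parcs G \<noteq> {}" and "single_valued (parcs G)"
proof -
  let ?q = "card (isolated_verts G)" and ?g = "power_domination_number G"
  obtain z where roots: "power_domination_roots G = {0, z}" and "z \<noteq> 0"
    using assms(2) zero_in_power_domination_roots
    by (metis card_2_iff doubleton_eq_iff insertE singletonD)
  define m where "m = order z (power_domination_poly G)"
  note eqs = nonzero_power_domination_root_equations[OF nonempty roots \<open>z \<noteq> 0\<close>, folded m_def]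
  obtain s where z: "z = - of_nat s" and "s > 0"
    using nonzero_power_domination_root_negative_int[OF nonempty roots \<open>z \<noteq> 0\<close>] by blast
  have card_nonisolated: "card (pverts G) - ?q = m * s"
    using eqs(3) z of_nat_eq_iff[of _ "m * s", where ?'a = complex] by simp
  show "parcs G \<noteq> {}"
  proof
    assume "parcs G = {}"
    then have "isolated_verts G = pverts G" by (auto simp: isolated_verts_def nbrs_def)
    then show False using card_nonisolated eqs(1) \<open>s > 0\<close> by simp
  qed
  then have "?q < ?g" by (rule card_isolated_verts_less_power_domination_number)
  then have "m * 1 < m * s" using card_nonisolated eqs(2) by linarith
  then have "m * 2 \<le> m * s" by simp
  then have "card (pverts G) + ?q \<le> 2 * ?g" using card_nonisolated eqs(1,2) by linarith
  then show "single_valued (parcs G)" by (rule single_valued_if_power_domination_number_maximal)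
qed

subsection \<open>Graphs with degrees at most one\<close>

lemma power_dominating_iff_dominating:
  assumes "single_valued (parcs G)"
  shows "power_dominating G S \<longleftrightarrow> dominating G S"
proof
  assume pd: "power_dominating G S"
  have "nbrs G u \<subseteq> closed_nbrs G S" if u: "u \<in> closed_nbrs G S" for u
  proof (cases "u \<in> S")
    case False
    then obtain s where s: "s \<in> S" "u \<in> nbrs G s" using u by (auto simp: in_closed_nbrs_iff)
    then have "nbrs G u = {s}" using nbrs_eq_singleton[OF assms] nbrs_sym by blast
    then show ?thesis using s(1) by (simp add: in_closed_nbrs_iff)
  qed (auto simp: in_closed_nbrs_iff)
  then have "force_step G (closed_nbrs G S) = closed_nbrs G S"
    by (fastforce simp: force_step_def)
  with pd show "dominating G S" by (rule power_dominating_imp_dominating_if_stalled)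
qed (rule power_dominating_if_dominating)

lemma dominating_iff_meets_closed_nbrs:
  "dominating G S \<longleftrightarrow> S \<subseteq> pverts G \<and> (\<forall>v\<in>pverts G. S \<inter> closed_nbrs G {v} \<noteq> {})"
proof -
  have "v \<in> closed_nbrs G S \<longleftrightarrow> S \<inter> closed_nbrs G {v} \<noteq> {}" for v
    unfolding in_closed_nbrs_iff closed_nbrs_singleton using nbrs_sym[of v] by blast
  then show ?thesis by (simp add: dominating_def subset_eq)
qed

lemma closed_nbrs_singleton_eq:
  assumes "single_valued (parcs G)" and "x \<in> closed_nbrs G {v}"
  shows "closed_nbrs G {x} = closed_nbrs G {v}"
proof (cases "x = v")
  case False
  then have "x \<in> nbrs G v" "v \<in> nbrs G x"
    using assms(2) nbrs_sym by (auto simp: closed_nbrs_singleton)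
  then have "nbrs G v = {x}" "nbrs G x = {v}" using nbrs_eq_singleton[OF assms(1)] by blast+
  then show ?thesis by (auto simp: closed_nbrs_singleton)
qed simp

lemma disjoint_closed_nbrs:
  assumes "single_valued (parcs G)"
  shows "disjoint ((\<lambda>v. closed_nbrs G {v}) ` A)"
proof (rule pairwise_imageI)
  fix u v assume "closed_nbrs G {u} \<noteq> closed_nbrs G {v}"
  then show "disjnt (closed_nbrs G {u}) (closed_nbrs G {v})"
    using closed_nbrs_singleton_eq[OF assms] unfolding disjnt_iff by metis
qed

lemma card_closed_nbrs_singleton:
  assumes "single_valued (parcs G)" and "v \<in> pverts G"
  shows "card (closed_nbrs G {v}) = (if v \<in> isolated_verts G then 1 else 2)"
proof (cases "nbrs G v = {}")
  case False
  then obtain w where w: "w \<in> nbrs G v" by blast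
  then have "w \<noteq> v" using nbrs_irrefl by blast
  then show ?thesis
    using nbrs_eq_singleton[OF assms(1) w] by (simp add: closed_nbrs_singleton isolated_verts_def)
qed (use assms(2) in \<open>simp add: closed_nbrs_singleton isolated_verts_def\<close>)

lemma poly_power_domination_poly_eq_prod:
  assumes "single_valued (parcs G)" and "pverts G \<noteq> {}"
  shows "poly (power_domination_poly G) x
    = (\<Prod>B \<in> (\<lambda>v. closed_nbrs G {v}) ` pverts G. (1 + x) ^ card B - 1)"
proof -
  let ?B = "(\<lambda>v. closed_nbrs G {v}) ` pverts G"
  have union: "\<Union>?B = pverts G" using nbrs_subset by (auto simp: closed_nbrs_singleton)
  then have "finite B" if "B \<in> ?B" for B
    using finite_subset_verts Union_upper[OF that] by simp
  moreover have "finite ?B" using pair_finite_verts by simp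
  ultimately have "(\<Sum>S | S \<subseteq> \<Union>?B \<and> (\<forall>B\<in>?B. S \<inter> B \<noteq> {}). x ^ card S)
      = (\<Prod>B\<in>?B. (1 + x) ^ card B - 1)"
    using disjoint_closed_nbrs[OF assms(1)] by (intro sum_power_card_hitting_sets)
  then show ?thesis
    by (simp add: poly_power_domination_poly[OF assms(2)] union dominating_iff_meets_closed_nbrs
        power_dominating_iff_dominating[OF assms(1)])
qed

lemma power_domination_roots_single_valued:
  assumes "single_valued (parcs G)" and "parcs G \<noteq> {}"
  shows "power_domination_roots G = {0, -2}"
proof -
  obtain u v where "(u, v) \<in> parcs G" using assms(2) by auto
  then have u: "u \<in> pverts G" "u \<notin> isolated_verts G"
    by (auto simp: isolated_verts_def nbrs_def dest: in_arcsD1)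
  then have nonempty: "pverts G \<noteq> {}" by blast
  have "(1 + z) ^ 2 - 1 = z * (z + 2)" for z :: complex
    by (simp add: power2_eq_square algebra_simps)
  then have factor: "(1 + z) ^ card (closed_nbrs G {v}) - 1
      = (if v \<in> isolated_verts G then z else z * (z + 2))" if "v \<in> pverts G" for v and z :: complex
    using card_closed_nbrs_singleton[OF assms(1) that] by simp
  show ?thesis
  proof (rule set_eqI)
    fix z :: complex
    have "z \<in> power_domination_roots G
        \<longleftrightarrow> (\<exists>v\<in>pverts G. (1 + z) ^ card (closed_nbrs G {v}) - 1 = 0)"
      using pair_finite_verts
      by (auto simp: power_domination_roots_def
          poly_power_domination_poly_eq_prod[OF assms(1) nonempty])
    also have "\<dots> \<longleftrightarrow> (\<exists>v\<in>pverts G. (if v \<in> isolated_verts G then z else z * (z + 2)) = 0)"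
      by (intro bex_cong refl) (simp only: factor)
    also have "\<dots> \<longleftrightarrow> z = 0 \<or> z = -2"
      using u by (auto simp: eq_neg_iff_add_eq_0)
    finally show "z \<in> power_domination_roots G \<longleftrightarrow> z \<in> {0, -2}" by simp
  qed
qed

lemma card_power_domination_roots_eq_2_iff:
  assumes "pverts G \<noteq> {}"
  shows "card (power_domination_roots G) = 2 \<longleftrightarrow> single_valued (parcs G) \<and> parcs G \<noteq> {}"
proof
  assume "card (power_domination_roots G) = 2"
  then show "single_valued (parcs G) \<and> parcs G \<noteq> {}"
    using two_power_domination_rootsD[OF assms] by blast
qed (simp add: power_domination_roots_single_valued)

end

subsection \<open>Disjoint unions of edges and isolated vertices\<close>

lemma graph_isoE:
  assumes "G \<simeq>\<^sub>G H"
  obtains f where "pair_wf_digraph G" and "inj_on f (pverts G)"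
    and "pverts H = f ` pverts G" and "parcs H = map_prod f f ` parcs G"
proof -
  from assms obtain h where h: "pre_digraph.digraph_isomorphism (with_proj G) h"
    and H: "with_proj H = app_iso h (with_proj G)"
    by (auto simp: digraph_iso_def)
  have ends: "iso_tail h = fst" "iso_head h = snd" and vH: "pverts H = iso_verts h ` pverts G"
    and aH: "parcs H = iso_arcs h ` parcs G"
    using H by (simp_all add: with_proj_def app_iso_def)
  have "iso_arcs h a = map_prod (iso_verts h) (iso_verts h) a" if "a \<in> parcs G" for a
    using h that by (cases a) (auto simp: pre_digraph.digraph_isomorphism_def ends prod_eq_iff)
  then have "parcs H = map_prod (iso_verts h) (iso_verts h) ` parcs G"
    unfolding aH by (intro image_cong) auto
  moreover have "pair_wf_digraph G" "inj_on (iso_verts h) (pverts G)"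
    using h by (simp_all add: pre_digraph.digraph_isomorphism_def wf_digraph_wp_iff)
  ultimately show thesis using vH by (intro that)
qed

lemma graph_isoI:
  assumes G: "pair_wf_digraph G" and inj: "inj_on f (pverts G)"
    and "pverts H = f ` pverts G" and "parcs H = map_prod f f ` parcs G"
  shows "G \<simeq>\<^sub>G H"
proof -
  let ?h = "\<lparr>iso_verts = f, iso_arcs = map_prod f f, iso_head = snd, iso_tail = fst\<rparr>"
  interpret pair_wf_digraph G by (rule G)
  have arcs: "parcs G \<subseteq> pverts G \<times> pverts G" by (auto dest: in_arcsD1 in_arcsD2)
  then have "inj_on (map_prod f f) (parcs G)"
    using map_prod_inj_on[OF inj inj] by (rule inj_on_subset[rotated])
  with inj have "pre_digraph.digraph_isomorphism (with_proj G) ?h"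
    using arcs wf_digraph_wp_iff G by (auto simp: pre_digraph.digraph_isomorphism_def)
  moreover have "with_proj H = app_iso ?h (with_proj G)"
    using assms by (simp add: with_proj_def app_iso_def)
  ultimately show ?thesis unfolding digraph_iso_def by blast
qed

lemma single_valued_iso:
  assumes "G \<simeq>\<^sub>G H" and "single_valued (parcs H)"
  shows "single_valued (parcs G)"
proof -
  from assms(1) obtain f where "pair_wf_digraph G" and inj: "inj_on f (pverts G)"
    and H: "parcs H = map_prod f f ` parcs G" by (rule graph_isoE)
  interpret pair_wf_digraph G by fact
  show ?thesis
  proof (rule single_valuedI)
    fix u v w assume uv: "(u, v) \<in> parcs G" and uw: "(u, w) \<in> parcs G"
    then have "(f u, f v) \<in> parcs H" "(f u, f w) \<in> parcs H" unfolding H by force+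
    then have "f v = f w" using assms(2) by (auto dest: single_valuedD)
    then show "v = w" using inj uv uw by (meson in_arcsD2 inj_onD)
  qed
qed

lemma parcs_empty_iso_iff: "G \<simeq>\<^sub>G H \<Longrightarrow> parcs G = {} \<longleftrightarrow> parcs H = {}"
  by (elim graph_isoE) auto

lemma parcs_path_graph_2: "parcs (path_graph 2) = {(0, 1), (1, 0)}"
  by (auto simp: path_graph_def)

lemma single_valued_graph_sum:
  assumes "single_valued (parcs G)" and "single_valued (parcs H)"
  shows "single_valued (parcs (G \<oplus>\<^sub>G H))"
  using assms by (auto simp: graph_sum_def intro!: single_valuedI dest: single_valuedD)

lemma single_valued_graph_family_sum:
  assumes "\<And>i. i \<in> I \<Longrightarrow> single_valued (parcs (F i))"
  shows "single_valued (parcs (graph_family_sum I F))"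
  using assms by (auto simp: graph_family_sum_def intro!: single_valuedI dest: single_valuedD)

lemma parcs_graph_sum_empty_iff: "parcs (G \<oplus>\<^sub>G H) = {} \<longleftrightarrow> parcs G = {} \<and> parcs H = {}"
  by (auto simp: graph_sum_def)

lemma parcs_graph_family_sum_empty_iff:
  "parcs (graph_family_sum I F) = {} \<longleftrightarrow> (\<forall>i\<in>I. parcs (F i) = {})"
  by (auto simp: graph_family_sum_def)

definition matching_graph :: "nat \<Rightarrow> nat \<Rightarrow> (nat \<times> nat + nat) pair_pre_digraph" where
  "matching_graph k r = graph_family_sum {1..k} (\<lambda>_. path_graph 2) \<oplus>\<^sub>G edgeless_graph r"

lemma pverts_matching_graph: "pverts (matching_graph k r) = {1..k} \<times> {0, 1} <+> {..<r}"
  by (auto simp: matching_graph_def graph_sum_def graph_family_sum_def path_graph_def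
      edgeless_graph_def)

lemma parcs_matching_graph:
  "parcs (matching_graph k r)
    = (\<lambda>i. (Inl (i, 0), Inl (i, 1))) ` {1..k} \<union> (\<lambda>i. (Inl (i, 1), Inl (i, 0))) ` {1..k}"
  unfolding matching_graph_def graph_sum_def graph_family_sum_def parcs_path_graph_2
  by (auto simp: edgeless_graph_def)

lemma pair_wf_digraph_matching_graph: "pair_wf_digraph (matching_graph k r)"
  by unfold_locales (auto simp: parcs_matching_graph pverts_matching_graph)

lemma bij_betw_case_sum:
  assumes "bij_betw f A C" and "bij_betw g B D" and "C \<inter> D = {}"
  shows "bij_betw (case_sum f g) (A <+> B) (C \<union> D)"
  unfolding Plus_def using assms
  by (intro bij_betw_combine) (simp_all add: bij_betw_def inj_on_def image_image)

lemma bij_betw_Times_zero_one: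
  assumes "bij_betw f A C" and "bij_betw g A D" and "C \<inter> D = {}"
  shows "bij_betw (\<lambda>(i, j :: nat). if j = 0 then f i else g i) (A \<times> {0, 1}) (C \<union> D)"
    (is "bij_betw ?h _ _")
proof -
  have "A \<times> {0, 1} = (\<lambda>i. (i, 0 :: nat)) ` A \<union> (\<lambda>i. (i, 1)) ` A" by auto
  moreover have "bij_betw ?h ((\<lambda>i. (i, 0)) ` A) C" "bij_betw ?h ((\<lambda>i. (i, 1)) ` A) D"
    using assms(1,2) by (simp_all add: bij_betw_def inj_on_def image_image)
  ultimately show ?thesis using assms(3) by (simp only: bij_betw_combine)
qed

context pair_graph
begin

lemma orientationE:
  obtains A where "parcs G = A \<union> A\<inverse>" and "A \<inter> A\<inverse> = {}"
proof -
  obtain g :: "'a \<Rightarrow> nat" where inj: "inj_on g (pverts G)"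
    using finite_imp_inj_to_nat_seg[OF pair_finite_verts] by blast
  let ?A = "{(u, v) \<in> parcs G. g u < g v}"
  have "g u \<noteq> g v" if "(u, v) \<in> parcs G" for u v
    using that inj pair_no_loops[OF that] by (auto dest: in_arcsD1 in_arcsD2 inj_onD)
  then have "parcs G = ?A \<union> ?A\<inverse>" using arcs_symmetric by (force simp: neq_iff)
  then show thesis by (rule that) auto
qed

lemma orientation_endpoints:
  assumes "parcs G = A \<union> A\<inverse>"
  shows "fst ` A \<union> snd ` A = pverts G - isolated_verts G"
proof -
  have "fst ` A \<union> snd ` A = Domain (parcs G)"
    by (simp add: assms Domain_Un_eq fst_eq_Domain snd_eq_Range)
  also have "\<dots> = pverts G - isolated_verts G"
    by (auto simp: isolated_verts_def nbrs_def dest: in_arcsD1)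
  finally show ?thesis .
qed

lemma orientation_single_valued:
  assumes "single_valued (parcs G)" and A: "parcs G = A \<union> A\<inverse>" "A \<inter> A\<inverse> = {}"
  shows "inj_on fst A" and "inj_on snd A" and "fst ` A \<inter> snd ` A = {}"
proof -
  have partner: "v = w" if "(u, v) \<in> A \<union> A\<inverse>" "(u, w) \<in> A \<union> A\<inverse>" for u v w
    using assms(1) that unfolding A(1) by (rule single_valuedD)
  show "inj_on fst A" "inj_on snd A" using partner by (fastforce intro: inj_onI)+
  show "fst ` A \<inter> snd ` A = {}" using partner A(2) by fastforce
qed

lemma graph_iso_matching_graph:
  assumes single: "single_valued (parcs G)" and "parcs G \<noteq> {}"
  obtains k r where "k \<ge> 1" and "G \<simeq>\<^sub>G matching_graph k r"
proof -
  let ?Z = "isolated_verts G"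
  obtain A where A: "parcs G = A \<union> A\<inverse>" "A \<inter> A\<inverse> = {}" by (rule orientationE)
  note verts = orientation_endpoints[OF A(1)]
  note orientation = orientation_single_valued[OF single A]
  have fin: "finite A" "finite ?Z"
    using pair_finite_arcs A(1) finite_subset_verts isolated_verts_subset by auto
  obtain e where e: "bij_betw e {1..card A} A"
    using ex_bij_betw_nat_finite_1[OF fin(1)] by blast
  obtain z where z: "bij_betw z {..<card ?Z} ?Z"
    using ex_bij_betw_nat_finite[OF fin(2)] by (auto simp: atLeast0LessThan)
  let ?H = "matching_graph (card A) (card ?Z)"
  let ?f = "case_sum (\<lambda>(i, j). if j = 0 then fst (e i) else snd (e i)) z"
  have "bij_betw (\<lambda>i. fst (e i)) {1..card A} (fst ` A)"
    "bij_betw (\<lambda>i. snd (e i)) {1..card A} (snd ` A)"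
    unfolding comp_def[symmetric]
    using bij_betw_trans[OF e inj_on_imp_bij_betw] orientation(1,2) by blast+
  then have "bij_betw ?f (pverts ?H) (fst ` A \<union> snd ` A \<union> ?Z)"
    unfolding pverts_matching_graph
    using z orientation(3) verts by (intro bij_betw_case_sum bij_betw_Times_zero_one) auto
  moreover have "fst ` A \<union> snd ` A \<union> ?Z = pverts G" using verts isolated_verts_subset by blast
  ultimately have "bij_betw ?f (pverts ?H) (pverts G)" by simp
  moreover have "parcs G = map_prod ?f ?f ` parcs ?H"
  proof -
    have "map_prod ?f ?f ` parcs ?H = e ` {1..card A} \<union> prod.swap ` e ` {1..card A}"
      by (simp add: parcs_matching_graph image_Un image_image prod.swap_def)
    moreover have "prod.swap ` A = A\<inverse>" by force
    ultimately show ?thesis using e A(1) by (simp add: bij_betw_def)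
  qed
  ultimately have "?H \<simeq>\<^sub>G G"
    using pair_wf_digraph_matching_graph
    by (intro graph_isoI[of _ ?f]) (simp_all add: bij_betw_def)
  then have "G \<simeq>\<^sub>G ?H"
    using pair_wf_digraph_matching_graph digraph_iso_swap by (metis wf_digraph_wp_iff)
  moreover have "card A \<ge> 1" using assms(2) A(1) fin(1) by (auto simp: Suc_le_eq card_gt_0_iff)
  ultimately show thesis using that by blast
qed

end

lemma single_valued_nonempty_if_iso_matching:
  assumes "\<forall>i\<in>I. F i \<simeq>\<^sub>G path_graph 2" and "I \<noteq> {}"
    and "G \<simeq>\<^sub>G graph_family_sum I F \<oplus>\<^sub>G edgeless_graph r"
  shows "single_valued (parcs G)" and "parcs G \<noteq> {}"
proof -
  have "single_valued (parcs (path_graph 2))"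
    by (simp add: parcs_path_graph_2 single_valued_def)
  then have "\<forall>i\<in>I. single_valued (parcs (F i))" using assms(1) single_valued_iso by blast
  then show "single_valued (parcs G)"
    by (intro single_valued_iso[OF assms(3)] single_valued_graph_sum single_valued_graph_family_sum)
      (simp_all add: edgeless_graph_def)
  have "\<forall>i\<in>I. parcs (F i) \<noteq> {}"
    using assms(1) parcs_empty_iso_iff by (metis insert_not_empty parcs_path_graph_2)
  then show "parcs G \<noteq> {}"
    using assms(2) parcs_empty_iso_iff[OF assms(3)]
    by (auto simp: parcs_graph_sum_empty_iff parcs_graph_family_sum_empty_iff)
qed

lemma path_graph_iso_refl: "path_graph n \<simeq>\<^sub>G path_graph n"
proof (rule graph_isoI[of _ id])
  show "pair_wf_digraph (path_graph n)" by unfold_locales (auto simp: path_graph_def)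
qed (simp_all add: map_prod.id)

lemma (in pair_graph) single_valued_nonempty_iff_iso_matching:
  "single_valued (parcs G) \<and> parcs G \<noteq> {} \<longleftrightarrow>
    (\<exists>(k::nat) (r::nat) (F :: nat \<Rightarrow> nat pair_pre_digraph).
      k \<ge> 1 \<and> (\<forall>i\<in>{1..k}. F i \<simeq>\<^sub>G path_graph 2) \<and>
      G \<simeq>\<^sub>G graph_family_sum {1..k} F \<oplus>\<^sub>G edgeless_graph r)" (is "_ \<longleftrightarrow> ?matching")
proof
  assume "single_valued (parcs G) \<and> parcs G \<noteq> {}"
  then obtain k r where "k \<ge> 1" "G \<simeq>\<^sub>G matching_graph k r"
    using graph_iso_matching_graph by blast
  then show ?matching
    by (intro exI[of _ k] exI[of _ r] exI[of _ "\<lambda>_. path_graph 2"])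
      (simp add: matching_graph_def path_graph_iso_refl)
next
  assume ?matching
  then obtain k r :: nat and F :: "nat \<Rightarrow> nat pair_pre_digraph"
    where F: "\<forall>i\<in>{1..k}. F i \<simeq>\<^sub>G path_graph 2" and k: "{1..k} \<noteq> {}"
      and iso: "G \<simeq>\<^sub>G graph_family_sum {1..k} F \<oplus>\<^sub>G edgeless_graph r"
    by force
  show "single_valued (parcs G) \<and> parcs G \<noteq> {}"
    using single_valued_nonempty_if_iso_matching[OF F k iso] by (rule conjI)
qed

theorem theorem32:
  fixes G :: "'a pair_pre_digraph"
  assumes "pair_graph G"
    and "pverts G \<noteq> {}"
  shows "(card (power_domination_roots G) = 2 \<longleftrightarrow>
           (\<exists>(k::nat) (r::nat) (F :: nat \<Rightarrow> nat pair_pre_digraph).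
              k \<ge> 1 \<and> (\<forall>i\<in>{1..k}. F i \<simeq>\<^sub>G path_graph 2) \<and>
              G \<simeq>\<^sub>G graph_family_sum {1..k} F \<oplus>\<^sub>G edgeless_graph r)) \<and>
         (card (power_domination_roots G) = 2 \<longrightarrow> power_domination_roots G = {0, -2})"
proof -
  interpret pair_graph G by (rule assms(1))
  have "card (power_domination_roots G) = 2 \<longrightarrow> power_domination_roots G = {0, -2}"
    by (simp add: card_power_domination_roots_eq_2_iff[OF assms(2)]
        power_domination_roots_single_valued)
  with card_power_domination_roots_eq_2_iff
    [OF assms(2), unfolded single_valued_nonempty_iff_iso_matching]
  show ?thesis by (rule conjI)
qed

end
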